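(* Let $\alpha\in(0,2]$. Let $X_1,X_2,\ldots$ be independent, not necessarily identically distributed random variables with $\mathsf{E}X_i=0$ and $0<\sigma_i^2=\mathsf{D}X_i<\infty$, $i\ge1$, satisfying the Lindeberg condition: for any $\tau>0$ $$\lim_{n\to\infty}\frac{1}{B_n^2}\sum_{i=1}^n\int_{|x|\ge\tau B_n}x^2\,d\mathsf{P}(X_i<x)=0 .$$ Let $N_1,N_2,\ldots$ be integer-valued nonnegative random variables defined on the same probability space so that for each $n$ the random variable $N_n$ is independent of the sequence $X_1,X_2,\ldots$. Moreover, let $N_n\to\infty$ in probability as $n\to\infty$. Then the distributions of the normalized random sums $S^*_{N_n}$ converge to the Linnik law with parameter $\alpha$, that is, $$\mathsf{P}\Big(\frac{S^*_{N_n}}{d_n}<x\Big)\Longrightarrow F^L_\alpha(x)$$ with some $d_n>0$, $d_n\to\infty$ as $n\to\infty$, if and only if $$\frac{B^2_{N_n}}{d_n^2}\Longrightarrow M_{\alpha/2}\quad(n\to\infty).$$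
   Context: $\mathsf{D}$ denotes variance. $S_n^*=X_1+\ldots+X_n$, $B_n^2=\sigma_1^2+\ldots+\sigma_n^2$, with empty sums equal to $0$; $S^*_{N_n}=X_1+\ldots+X_{N_n}$, and $B^2_{N_n}$ is $B^2_n$ with $n$ replaced by $N_n$. $\{d_n\}_{n\ge1}$ is an infinitely increasing sequence of positive numbers, the same in both relations. $\Longrightarrow$ denotes convergence in distribution. $N_n\to\infty$ in probability means $\mathsf{P}(N_n\le m)\to0$ as $n\to\infty$ for any $m\in(0,\infty)$. $F^L_\alpha$ is the distribution function of the Linnik distribution with parameter $\alpha\in(0,2]$, which has characteristic function $1/(1+|t|^{\alpha})$, $t\in\mathbb{R}$. For $\delta\in(0,1]$, $M_\delta$ is a nonnegative random variable with the (standard) Mittag-Leffler distribution with parameter $\delta$, i.e. with Laplace transform $\mathsf{E}e^{-sM_\delta}=1/(1+s^{\delta})$, $s\ge 0$.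
   Formalization: The limit of B²_{N_n}/d_n² is taken to be 2·M_{α/2} instead of M_{α/2}, because with the stated normalisations and the same d_n the printed equivalence fails (e.g. α=2, standard normal X_i, geometric N_n with mean n, d_n=√n). *)

theory Defs
  imports "HOL-Probability.Probability"
begin

definition partial_sum :: "(nat \<Rightarrow> 'a \<Rightarrow> real) \<Rightarrow> nat \<Rightarrow> 'a \<Rightarrow> real" where
  "partial_sum X n \<omega> = (\<Sum>i=1..n. X i \<omega>)"

definition var_sum :: "'a measure \<Rightarrow> (nat \<Rightarrow> 'a \<Rightarrow> real) \<Rightarrow> nat \<Rightarrow> real" where
  "var_sum M X n = (\<Sum>i=1..n. prob_space.variance M (X i))"

definition lindeberg_condition :: "'a measure \<Rightarrow> (nat \<Rightarrow> 'a \<Rightarrow> real) \<Rightarrow> bool" where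
  "lindeberg_condition M X \<longleftrightarrow>
    (\<forall>\<tau>>0. (\<lambda>n. 1 / var_sum M X n *
        (\<Sum>i=1..n. LINT x:{x. \<bar>x\<bar> \<ge> \<tau> * sqrt (var_sum M X n)}|distr M borel (X i). x\<^sup>2))
      \<longlonglongrightarrow> 0)"

text \<open>
  The library's \<open>indep_var\<close> forces both random variables to take values in the same
  type. The definition below is its characterisation \<open>indep_var_eq\<close> without that restriction.
\<close>

definition independent_rvs ::
  "'a measure \<Rightarrow> 'b measure \<Rightarrow> ('a \<Rightarrow> 'b) \<Rightarrow> 'c measure \<Rightarrow> ('a \<Rightarrow> 'c) \<Rightarrow> bool" where
  "independent_rvs M S U T V \<longleftrightarrow>
    U \<in> measurable M S \<and> V \<in> measurable M T \<and>
    prob_space.indep_set M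
      (sigma_sets (space M) {U -` A \<inter> space M | A. A \<in> sets S})
      (sigma_sets (space M) {V -` A \<inter> space M | A. A \<in> sets T})"

text \<open>
  The next two predicates characterise the laws by their transforms; each determines
  its law uniquely, so one may speak of the Linnik and the Mittag-Leffler distribution.
\<close>

definition linnik_distribution :: "real \<Rightarrow> real measure \<Rightarrow> bool" where
  "linnik_distribution \<alpha> L \<longleftrightarrow>
    real_distribution L \<and> (\<forall>t. char L t = complex_of_real (1 / (1 + \<bar>t\<bar> powr \<alpha>)))"

definition mittag_leffler_distribution :: "real \<Rightarrow> real measure \<Rightarrow> bool" where
  "mittag_leffler_distribution \<delta> Q \<longleftrightarrow>
    real_distribution Q \<and> (AE x in Q. 0 \<le> x) \<and>
    (\<forall>s\<ge>0. (LINT x|Q. exp (- s * x)) = 1 / (1 + s powr \<delta>))"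

text \<open>
  With these normalisations the Linnik law with parameter \<open>\<alpha>\<close> is the law of
  \<open>Z * sqrt (2 * W)\<close>, where \<open>Z\<close> is standard normal and \<open>W\<close> is an independent Mittag-Leffler
  variable with parameter \<open>\<alpha> / 2\<close>: its characteristic function at \<open>t\<close> is
  \<open>E (exp (- t\<^sup>2 * W)) = 1 / (1 + \<bar>t\<bar> powr \<alpha>)\<close>. Without the factor 2 one obtains a rescaled Linnik law.
  Hence random sums normalised by \<open>d\<close> have a standard Linnik limit exactly when the random
  variances normalised by \<open>d\<^sup>2\<close> converge to the law of \<open>2 * W\<close>.
\<close>

end

theory Submission
  imports Defs
begin

text \<open>
  Let \<open>\<psi>\<^sub>k\<close> be the characteristic function of \<open>S\<^sub>k = X\<^sub>1 + ... + X\<^sub>k\<close> and \<open>B\<^sub>k\<^sup>2\<close> the variance of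
  \<open>S\<^sub>k\<close>. Lindeberg's condition makes \<open>S\<^sub>k\<close> approximately normal, and the point is that it does so
  in a form that is uniform in \<open>k\<close>: the supremum over all \<open>k\<close> of
  \<open>\<bar>\<psi>\<^sub>k s - exp (- s\<^sup>2 * B\<^sub>k\<^sup>2 / 2)\<bar>\<close> tends to 0 as \<open>s\<close> tends to 0 (\<open>sum_char_gaussian_uniform\<close>).
  Therefore \<open>k\<close> may be replaced by an independent random index and \<open>s\<close> by \<open>t / d n\<close>: the
  characteristic function of the normalised random sum at \<open>t\<close> and the Laplace transform of the
  normalised random variance at \<open>t\<^sup>2 / 2\<close> have vanishing difference
  (\<open>char_random_sum_minus_laplace_tendsto_0\<close>).

  The two limit laws are related in the same way: the Linnik characteristic function at \<open>t\<close> is the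
  Laplace transform of the doubled Mittag-Leffler law at \<open>t\<^sup>2 / 2\<close>. So the random sums have
  characteristic functions converging to that of the Linnik law if and only if the random variances
  have Laplace transforms converging to that of the doubled Mittag-Leffler law. Levy's continuity
  theorem on the one side and its analogue for Laplace transforms of laws on the half-line
  (\<open>laplace_continuity\<close>) on the other side translate this into weak convergence.
\<close>

section \<open>Second-order expansions\<close>

text \<open>
  The remainder of the second-order expansion is controlled by \<open>min (6 * x\<^sup>2) (\<bar>s\<bar> * \<bar>x\<bar> ^ 3)\<close>.
  Splitting at level \<open>c\<close>, the quadratic branch is used on the tail and the cubic one, bounded by
  \<open>\<bar>s\<bar> * c * x\<^sup>2\<close>, near the origin. What remains is the tail integral of
  Lindeberg's condition and a multiple of the variance that is small with \<open>c\<close>.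
\<close>

lemma (in real_distribution) char_second_order_tail_bound:
  assumes [simp]: "integrable M (\<lambda>x. x)" and sq [simp]: "integrable M (\<lambda>x. x\<^sup>2)"
    and mean: "expectation (\<lambda>x. x) = 0" and "0 \<le> c"
  shows "cmod (char M s - (1 - s\<^sup>2 * variance (\<lambda>x. x) / 2)) \<le>
    s\<^sup>2 * (LINT x:{x. c \<le> \<bar>x\<bar>}|M. x\<^sup>2) + \<bar>s\<bar> ^ 3 * c * variance (\<lambda>x. x) / 6"
proof -
  have [simp]: "integrable M (\<lambda>x. indicator {x. c \<le> \<bar>x\<bar>} x * x\<^sup>2)"
    using integrable_mult_indicator[OF _ sq, of "{x. c \<le> \<bar>x\<bar>}"] by simp
  have "expectation (\<lambda>x. min (6 * x\<^sup>2) (\<bar>s\<bar> * \<bar>x\<bar> ^ 3)) \<le>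
      expectation (\<lambda>x. 6 * (indicator {x. c \<le> \<bar>x\<bar>} x * x\<^sup>2) + \<bar>s\<bar> * c * x\<^sup>2)"
  proof (rule integral_mono)
    show "integrable M (\<lambda>x. min (6 * x\<^sup>2) (\<bar>s\<bar> * \<bar>x\<bar> ^ 3))"
      by (rule Bochner_Integration.integrable_bound[of _ "\<lambda>x. 6 * x\<^sup>2"]) (auto simp: abs_of_nonneg)
    fix x :: real
    have "\<bar>s\<bar> * \<bar>x\<bar> ^ 3 \<le> \<bar>s\<bar> * c * x\<^sup>2" if "\<bar>x\<bar> < c"
    proof -
      have "\<bar>s\<bar> * \<bar>x\<bar> ^ 3 = \<bar>s\<bar> * \<bar>x\<bar> * x\<^sup>2" by (simp add: power3_eq_cube power2_eq_square)
      also have "\<dots> \<le> \<bar>s\<bar> * c * x\<^sup>2" using that by (intro mult_right_mono mult_left_mono) auto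
      finally show ?thesis .
    qed
    then show "min (6 * x\<^sup>2) (\<bar>s\<bar> * \<bar>x\<bar> ^ 3) \<le> 6 * (indicator {x. c \<le> \<bar>x\<bar>} x * x\<^sup>2) + \<bar>s\<bar> * c * x\<^sup>2"
      using \<open>0 \<le> c\<close> by (cases "c \<le> \<bar>x\<bar>") (simp_all add: min.coboundedI1 min.coboundedI2)
  qed simp
  also have "\<dots> = 6 * (LINT x:{x. c \<le> \<bar>x\<bar>}|M. x\<^sup>2) + \<bar>s\<bar> * c * variance (\<lambda>x. x)"
    by (simp add: set_lebesgue_integral_def mean)
  finally have "(s\<^sup>2 / 6) * expectation (\<lambda>x. min (6 * x\<^sup>2) (\<bar>s\<bar> * \<bar>x\<bar> ^ 3)) \<le>
      (s\<^sup>2 / 6) * (6 * (LINT x:{x. c \<le> \<bar>x\<bar>}|M. x\<^sup>2) + \<bar>s\<bar> * c * variance (\<lambda>x. x))"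
    by (intro mult_left_mono) auto
  also have "\<dots> = s\<^sup>2 * (LINT x:{x. c \<le> \<bar>x\<bar>}|M. x\<^sup>2) + \<bar>s\<bar> ^ 3 * c * variance (\<lambda>x. x) / 6"
    by (simp add: field_simps power3_eq_cube power2_eq_square)
  finally show ?thesis
    using char_approx3[of "variance (\<lambda>x. x)" s] mean by simp
qed

text \<open>
  This turns Lindeberg's condition into negligibility of each single summand.
\<close>

lemma (in real_distribution) variance_le_tail:
  assumes sq: "integrable M (\<lambda>x. x\<^sup>2)" and mean: "expectation (\<lambda>x. x) = 0"
  shows "variance (\<lambda>x. x) \<le> c\<^sup>2 + (LINT x:{x. c \<le> \<bar>x\<bar>}|M. x\<^sup>2)"
proof -
  have I: "integrable M (\<lambda>x. indicator {x. c \<le> \<bar>x\<bar>} x * x\<^sup>2)"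
    using integrable_mult_indicator[OF _ sq, of "{x. c \<le> \<bar>x\<bar>}"] by simp
  have "expectation (\<lambda>x. x\<^sup>2) \<le> expectation (\<lambda>x. c\<^sup>2 + indicator {x. c \<le> \<bar>x\<bar>} x * x\<^sup>2)"
    using sq I by (intro integral_mono) (auto simp: indicator_def abs_le_square_iff[symmetric])
  also have "\<dots> = c\<^sup>2 + (LINT x:{x. c \<le> \<bar>x\<bar>}|M. x\<^sup>2)"
    using I prob_space by (simp add: set_lebesgue_integral_def)
  finally show ?thesis by (simp add: mean)
qed

lemma exp_minus_second_order:
  fixes x :: real
  assumes "0 \<le> x"
  shows "\<bar>exp (- x) - (1 - x)\<bar> \<le> x\<^sup>2 / 2"
proof -
  have "(\<lambda>y. 1 - y + y\<^sup>2 / 2 - exp (- y)) 0 \<le> (\<lambda>y. 1 - y + y\<^sup>2 / 2 - exp (- y)) x"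
  proof (rule DERIV_nonneg_imp_nondecreasing[OF assms])
    fix y :: real
    have "((\<lambda>y. 1 - y + y\<^sup>2 / 2 - exp (- y)) has_real_derivative (- 1 + y + exp (- y))) (at y)"
      by (auto intro!: derivative_eq_intros)
    moreover have "0 \<le> - 1 + y + exp (- y)"
      using exp_ge_add_one_self[of "- y"] by simp
    ultimately show "\<exists>z. ((\<lambda>y. 1 - y + y\<^sup>2 / 2 - exp (- y)) has_real_derivative z) (at y) \<and> 0 \<le> z"
      by blast
  qed
  moreover have "1 - x \<le> exp (- x)"
    using exp_ge_add_one_self[of "- x"] by simp
  ultimately show ?thesis by simp
qed

section \<open>Uniform Gaussian approximation under Lindeberg's condition\<close>

text \<open>
  The quantity that Lindeberg's condition requires to vanish as \<open>n\<close> grows, for each fixed \<open>\<tau>\<close>.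
\<close>

definition lindeberg_ratio :: "'a measure \<Rightarrow> (nat \<Rightarrow> 'a \<Rightarrow> real) \<Rightarrow> real \<Rightarrow> nat \<Rightarrow> real" where
  "lindeberg_ratio M X \<tau> n = 1 / var_sum M X n *
    (\<Sum>i=1..n. LINT x:{x. \<bar>x\<bar> \<ge> \<tau> * sqrt (var_sum M X n)}|distr M borel (X i). x\<^sup>2)"

locale centered_summands = prob_space M for M :: "'a measure" +
  fixes X :: "nat \<Rightarrow> 'a \<Rightarrow> real"
  assumes indep: "indep_vars (\<lambda>_. borel) X {1..}"
    and integrable_X: "i \<ge> 1 \<Longrightarrow> integrable M (X i)"
    and integrable_square: "i \<ge> 1 \<Longrightarrow> integrable M (\<lambda>\<omega>. (X i \<omega>)\<^sup>2)"
    and mean_zero: "i \<ge> 1 \<Longrightarrow> expectation (X i) = 0"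
    and variance_pos: "i \<ge> 1 \<Longrightarrow> 0 < variance (X i)"
begin

abbreviation law :: "nat \<Rightarrow> real measure" where
  "law i \<equiv> distr M borel (X i)"

abbreviation sum_char :: "nat \<Rightarrow> real \<Rightarrow> complex" where
  "sum_char k \<equiv> char (distr M borel (partial_sum X k))"

lemma rv_X [measurable]: "i \<ge> 1 \<Longrightarrow> X i \<in> borel_measurable M"
  using indep by (auto simp: indep_vars_def)

lemma partial_sum_measurable [measurable]: "partial_sum X k \<in> borel_measurable M"
  unfolding partial_sum_def[abs_def] by (intro borel_measurable_sum) auto

lemma real_distribution_law: "i \<ge> 1 \<Longrightarrow> real_distribution (law i)"
  by simp

lemma law_moments:
  assumes "i \<ge> 1"
  shows "integrable (law i) (\<lambda>x. x)" "integrable (law i) (\<lambda>x. x\<^sup>2)"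
    "(LINT x|law i. x) = 0" "(LINT x|law i. (x - (LINT x|law i. x))\<^sup>2) = variance (X i)"
  using assms integrable_X integrable_square mean_zero
  by (auto simp: integrable_distr_eq integral_distr)

lemma tail_nonneg: "0 \<le> (LINT x:A|law i. x\<^sup>2)"
  unfolding set_lebesgue_integral_def by (intro integral_nonneg_AE) auto

lemma var_sum_nonneg: "0 \<le> var_sum M X n"
  unfolding var_sum_def by (intro sum_nonneg) (auto intro: integral_nonneg_AE)

lemma var_sum_Suc: "var_sum M X (Suc n) = var_sum M X n + variance (X (Suc n))"
  by (simp add: var_sum_def)

lemma var_sum_mono: "m \<le> n \<Longrightarrow> var_sum M X m \<le> var_sum M X n"
  unfolding var_sum_def by (intro sum_mono2) (auto intro: integral_nonneg_AE)

lemma var_sum_pos: "n \<ge> 1 \<Longrightarrow> 0 < var_sum M X n"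
  unfolding var_sum_def using variance_pos by (intro sum_pos) auto

lemma lindeberg_ratio_nonneg: "0 \<le> lindeberg_ratio M X \<tau> n"
  unfolding lindeberg_ratio_def by (intro mult_nonneg_nonneg sum_nonneg tail_nonneg) (simp add: var_sum_nonneg)

lemma sum_tails_eq:
  assumes "n \<ge> 1"
  shows "(\<Sum>i=1..n. LINT x:{x. \<tau> * sqrt (var_sum M X n) \<le> \<bar>x\<bar>}|law i. x\<^sup>2) = var_sum M X n * lindeberg_ratio M X \<tau> n"
  using var_sum_pos[OF assms] by (simp add: lindeberg_ratio_def)

lemma variance_le_lindeberg:
  assumes "1 \<le> i" "i \<le> n"
  shows "variance (X i) \<le> var_sum M X n * (\<tau>\<^sup>2 + lindeberg_ratio M X \<tau> n)"
proof -
  interpret law: real_distribution "law i" using assms by (intro real_distribution_law)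
  let ?c = "\<tau> * sqrt (var_sum M X n)"
  have "variance (X i) \<le> ?c\<^sup>2 + (LINT x:{x. ?c \<le> \<bar>x\<bar>}|law i. x\<^sup>2)"
    using law.variance_le_tail[of ?c] law_moments[OF \<open>1 \<le> i\<close>] by simp
  also have "(LINT x:{x. ?c \<le> \<bar>x\<bar>}|law i. x\<^sup>2) \<le> (\<Sum>i=1..n. LINT x:{x. ?c \<le> \<bar>x\<bar>}|law i. x\<^sup>2)"
    using assms by (intro member_le_sum) (auto intro: tail_nonneg)
  also have "?c\<^sup>2 = var_sum M X n * \<tau>\<^sup>2"
    using var_sum_nonneg[of n] by (simp add: power_mult_distrib)
  finally show ?thesis
    using assms sum_tails_eq[of n \<tau>] by (simp add: algebra_simps)
qed

lemma sum_char_eq_prod: "sum_char k s = (\<Prod>i=1..k. char (law i) s)"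
  unfolding partial_sum_def[abs_def] by (rule char_distr_sum) (rule indep_vars_subset[OF indep], auto)

lemma cmod_char_law_le_1: "i \<ge> 1 \<Longrightarrow> cmod (char (law i) s) \<le> 1"
  by (rule real_distribution.cmod_char_le_1) simp

text \<open>
  The characteristic function of a longer sum has additional factors, all in the unit disc. This is
  what later bounds the characteristic function of long sums where no Gaussian approximation is
  available.
\<close>

lemma sum_char_antimono:
  assumes "m \<le> k"
  shows "cmod (sum_char k s) \<le> cmod (sum_char m s)"
proof -
  have "{1..k} = {1..m} \<union> {m<..k}" using assms by auto
  then have "sum_char k s = sum_char m s * (\<Prod>i\<in>{m<..k}. char (law i) s)"
    unfolding sum_char_eq_prod by (simp add: prod.union_disjoint ivl_disj_int)
  moreover have "cmod (\<Prod>i\<in>{m<..k}. char (law i) s) \<le> 1"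
    unfolding prod_norm[symmetric] by (intro prod_le_1) (auto simp: cmod_char_law_le_1)
  ultimately show ?thesis
    by (simp add: norm_mult mult_left_le)
qed

text \<open>
  The quantitative central limit theorem. Both sides are products over the summands with factors in
  the unit disc, so their distance is at most the sum of the distances of the factors. Both factors
  are compared with \<open>1 - s\<^sup>2 * \<sigma>\<^sub>i\<^sup>2 / 2\<close>: the characteristic function by
  \<open>char_second_order_tail_bound\<close>, the Gaussian factor up to \<open>s ^ 4 * \<sigma>\<^sub>i ^ 4 / 8\<close>, where one of
  the two variances is replaced by the uniform bound \<open>variance_le_lindeberg\<close>. The bound depends on
  \<open>s\<close> only through \<open>R\<close>, hence is uniform over \<open>\<bar>s\<bar> * B\<^sub>n \<le> R\<close>.
\<close>

lemma sum_char_gaussian_bound: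
  assumes n: "n \<ge> 1" and "0 \<le> \<tau>" and R: "\<bar>s\<bar> * sqrt (var_sum M X n) \<le> R"
  shows "cmod (sum_char n s - exp (- (s\<^sup>2 * var_sum M X n / 2))) \<le>
    R\<^sup>2 * (lindeberg_ratio M X \<tau> n + R * \<tau> / 6) + R ^ 4 * (\<tau>\<^sup>2 + lindeberg_ratio M X \<tau> n) / 8"
    (is "_ \<le> R\<^sup>2 * (?L + _) + _")
proof -
  let ?B2 = "var_sum M X n" and ?v = "\<lambda>i. variance (X i)"
  let ?c = "\<tau> * sqrt ?B2"
  let ?T = "\<lambda>i. LINT x:{x. ?c \<le> \<bar>x\<bar>}|law i. x\<^sup>2"
  have B2: "0 < ?B2" using n by (rule var_sum_pos)
  have v0: "0 \<le> ?v i" for i by (auto intro: integral_nonneg_AE)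
  have L0: "0 \<le> ?L" by (rule lindeberg_ratio_nonneg)
  have R0: "0 \<le> R" by (rule order_trans[OF _ R]) (use B2 in simp)
  have sB: "s\<^sup>2 * ?B2 \<le> R\<^sup>2"
    using power_mono[OF R, of 2] B2 by (simp add: power_mult_distrib)
  have summand: "cmod (char (law i) s - exp (- (s\<^sup>2 * ?v i / 2))) \<le>
      s\<^sup>2 * ?T i + \<bar>s\<bar> ^ 3 * ?c * ?v i / 6 + s ^ 4 * (?B2 * (\<tau>\<^sup>2 + ?L)) * ?v i / 8"
    if i: "i \<in> {1..n}" for i
  proof -
    interpret law: real_distribution "law i" using i by (intro real_distribution_law) auto
    have "cmod (char (law i) s - (1 - s\<^sup>2 * ?v i / 2)) \<le> s\<^sup>2 * ?T i + \<bar>s\<bar> ^ 3 * ?c * ?v i / 6"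
      using law.char_second_order_tail_bound[of ?c s] law_moments[of i] i \<open>0 \<le> \<tau>\<close> var_sum_nonneg by simp
    moreover have "cmod (complex_of_real (1 - s\<^sup>2 * ?v i / 2) - exp (- (s\<^sup>2 * ?v i / 2))) \<le> s ^ 4 * (?B2 * (\<tau>\<^sup>2 + ?L)) * ?v i / 8"
    proof -
      have "cmod (complex_of_real (1 - s\<^sup>2 * ?v i / 2) - exp (- (s\<^sup>2 * ?v i / 2))) =
          \<bar>exp (- (s\<^sup>2 * ?v i / 2)) - (1 - s\<^sup>2 * ?v i / 2)\<bar>"
        unfolding of_real_diff[symmetric] norm_of_real by simp
      also have "\<dots> \<le> (s\<^sup>2 * ?v i / 2)\<^sup>2 / 2"
        using v0 by (intro exp_minus_second_order) auto
      also have "\<dots> = s ^ 4 * ?v i * ?v i / 8" by (simp add: power2_eq_square power4_eq_xxxx)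
      also have "\<dots> \<le> s ^ 4 * (?B2 * (\<tau>\<^sup>2 + ?L)) * ?v i / 8"
        using variance_le_lindeberg[of i n \<tau>] i v0
        by (intro divide_right_mono mult_right_mono mult_left_mono) auto
      finally show ?thesis .
    qed
    ultimately show ?thesis
      using norm_triangle_ineq[of "char (law i) s - (1 - s\<^sup>2 * ?v i / 2)"
          "complex_of_real (1 - s\<^sup>2 * ?v i / 2) - exp (- (s\<^sup>2 * ?v i / 2))"] by simp
  qed
  have expB: "complex_of_real (exp (- (s\<^sup>2 * ?B2 / 2))) = (\<Prod>i=1..n. complex_of_real (exp (- (s\<^sup>2 * ?v i / 2))))"
    unfolding of_real_prod[symmetric]
    by (subst exp_sum[symmetric]) (auto simp: var_sum_def sum_negf sum_distrib_left sum_divide_distrib)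
  have "cmod (sum_char n s - complex_of_real (exp (- (s\<^sup>2 * ?B2 / 2)))) \<le>
      (\<Sum>i=1..n. cmod (char (law i) s - complex_of_real (exp (- (s\<^sup>2 * ?v i / 2)))))"
    unfolding sum_char_eq_prod expB using v0 by (intro norm_prod_diff) (auto simp: cmod_char_law_le_1)
  also have "\<dots> \<le> (\<Sum>i=1..n. s\<^sup>2 * ?T i + \<bar>s\<bar> ^ 3 * ?c * ?v i / 6 + s ^ 4 * (?B2 * (\<tau>\<^sup>2 + ?L)) * ?v i / 8)"
    using summand by (intro sum_mono) simp
  also have "\<dots> = s\<^sup>2 * (\<Sum>i=1..n. ?T i) + \<bar>s\<bar> ^ 3 * ?c * ?B2 / 6 + s ^ 4 * (?B2 * (\<tau>\<^sup>2 + ?L)) * ?B2 / 8"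
    by (simp add: var_sum_def sum.distrib sum_distrib_left sum_divide_distrib)
  also have "\<dots> = s\<^sup>2 * ?B2 * ?L + (s\<^sup>2 * ?B2) * (\<bar>s\<bar> * sqrt ?B2) * \<tau> / 6 + (s\<^sup>2 * ?B2)\<^sup>2 * (\<tau>\<^sup>2 + ?L) / 8"
    using n by (subst sum_tails_eq) (auto simp: power2_eq_square power3_eq_cube power4_eq_xxxx algebra_simps)
  also have "\<dots> \<le> R\<^sup>2 * ?L + R\<^sup>2 * R * \<tau> / 6 + (R\<^sup>2)\<^sup>2 * (\<tau>\<^sup>2 + ?L) / 8"
    using sB R R0 L0 \<open>0 \<le> \<tau>\<close> B2
    by (intro add_mono divide_right_mono mult_right_mono mult_mono power_mono) auto
  finally show ?thesis by (simp add: algebra_simps power2_eq_square power4_eq_xxxx)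
qed


context
  assumes lindeberg: "lindeberg_condition M X"
begin

lemma lindeberg_ratio_tendsto: "\<tau> > 0 \<Longrightarrow> lindeberg_ratio M X \<tau> \<longlonglongrightarrow> 0"
  using lindeberg unfolding lindeberg_condition_def lindeberg_ratio_def[abs_def] by blast

text \<open>
  In the explicit bound \<open>\<tau>\<close> is chosen first, to make the terms without Lindeberg ratio small;
  the remaining terms vanish as \<open>n\<close> grows.
\<close>

lemma sum_char_gaussian_uniform_bounded:
  assumes "0 < \<epsilon>"
  shows "\<forall>\<^sub>F n in sequentially. \<forall>s. \<bar>s\<bar> * sqrt (var_sum M X n) \<le> R \<longrightarrow>
    cmod (sum_char n s - exp (- (s\<^sup>2 * var_sum M X n / 2))) < \<epsilon>"
proof -
  \<comment> \<open>Zeros stand for the Lindeberg ratio, which vanishes in the limit.\<close>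
  have "((\<lambda>\<tau>. R\<^sup>2 * (0 + R * \<tau> / 6) + R ^ 4 * (\<tau>\<^sup>2 + 0) / 8) \<longlongrightarrow> R\<^sup>2 * (0 + R * 0 / 6) + R ^ 4 * (0\<^sup>2 + 0) / 8) (at_right 0)"
    by (intro tendsto_intros) auto
  then have "\<forall>\<^sub>F \<tau> in at_right 0. R\<^sup>2 * (0 + R * \<tau> / 6) + R ^ 4 * (\<tau>\<^sup>2 + 0) / 8 < \<epsilon>"
    by (rule order_tendstoD) (use assms in simp)
  then have "\<forall>\<^sub>F \<tau> in at_right 0. 0 < \<tau> \<and> R\<^sup>2 * (0 + R * \<tau> / 6) + R ^ 4 * (\<tau>\<^sup>2 + 0) / 8 < \<epsilon>"
    by (intro eventually_conj eventually_at_right_less)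
  then obtain \<tau> where \<tau>: "0 < \<tau>" "R\<^sup>2 * (0 + R * \<tau> / 6) + R ^ 4 * (\<tau>\<^sup>2 + 0) / 8 < \<epsilon>"
    using eventually_happens'[OF trivial_limit_at_right_real] by blast
  have "(\<lambda>n. R\<^sup>2 * (lindeberg_ratio M X \<tau> n + R * \<tau> / 6) + R ^ 4 * (\<tau>\<^sup>2 + lindeberg_ratio M X \<tau> n) / 8)
      \<longlonglongrightarrow> R\<^sup>2 * (0 + R * \<tau> / 6) + R ^ 4 * (\<tau>\<^sup>2 + 0) / 8"
    by (intro tendsto_intros lindeberg_ratio_tendsto \<tau>) auto
  then have "\<forall>\<^sub>F n in sequentially. R\<^sup>2 * (lindeberg_ratio M X \<tau> n + R * \<tau> / 6) + R ^ 4 * (\<tau>\<^sup>2 + lindeberg_ratio M X \<tau> n) / 8 < \<epsilon>"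
    by (rule order_tendstoD) (rule \<tau>)
  with eventually_ge_at_top[of 1] show ?thesis
  proof eventually_elim
    case (elim n)
    show ?case
      using elim \<tau>(1) by (intro allI impI order_le_less_trans[OF sum_char_gaussian_bound]) auto
  qed
qed

text \<open>
  A single summand cannot dominate the variance, so for small \<open>s\<close> the increasing sequence
  \<open>\<bar>s\<bar> * B\<^sub>m\<close> cannot jump over an interval from \<open>R / 2\<close> to \<open>R\<close>.
\<close>

lemma var_sum_Suc_le: "\<forall>\<^sub>F n in sequentially. var_sum M X (Suc n) \<le> 4 * var_sum M X n"
proof -
  \<comment> \<open>With \<open>\<tau> = 1/2\<close> the last summand has at most the fraction \<open>1/4 + 1/2\<close> of the variance.\<close>
  have "(\<lambda>n. lindeberg_ratio M X (1/2) (Suc n)) \<longlonglongrightarrow> 0"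
    using lindeberg_ratio_tendsto[of "1/2"] by (intro LIMSEQ_Suc) simp
  then have "\<forall>\<^sub>F n in sequentially. lindeberg_ratio M X (1/2) (Suc n) < 1/2"
    by (rule order_tendstoD) simp
  then show ?thesis
  proof eventually_elim
    case (elim n)
    have "variance (X (Suc n)) \<le> var_sum M X (Suc n) * ((1/2)\<^sup>2 + lindeberg_ratio M X (1/2) (Suc n))"
      by (intro variance_le_lindeberg) auto
    also have "\<dots> \<le> var_sum M X (Suc n) * (3/4)"
      using elim by (intro mult_left_mono var_sum_nonneg) (simp add: power2_eq_square)
    finally show ?case using var_sum_Suc[of n] by simp
  qed
qed

text \<open>
  The Gaussian approximation holds for small \<open>s\<close> simultaneously for all lengths \<open>k\<close>, which is
  what allows \<open>k\<close> to be replaced by a random index. Finitely many short sums are handled by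
  continuity at 0, and long sums with \<open>\<bar>s\<bar> * B\<^sub>k \<le> R\<close> by the central limit theorem above. If
  \<open>\<bar>s\<bar> * B\<^sub>k > R\<close>, the approximation error cannot be estimated directly, but both terms are small:
  the sum can be cut at an \<open>m < k\<close> with \<open>R / 2 \<le> \<bar>s\<bar> * B\<^sub>m \<le> R\<close>, where the characteristic function
  is close to a Gaussian value of at most \<open>exp (- R\<^sup>2 / 8)\<close>, and the remaining summands do not
  increase its modulus.
\<close>

lemma sum_char_gaussian_uniform:
  assumes "0 < \<epsilon>"
  shows "\<forall>\<^sub>F s in nhds 0. \<forall>k. cmod (sum_char k s - exp (- (s\<^sup>2 * var_sum M X k / 2))) < \<epsilon>"
proof -
  let ?B2 = "var_sum M X"
  let ?D = "\<lambda>k s. sum_char k s - complex_of_real (exp (- (s\<^sup>2 * ?B2 k / 2)))"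
  \<comment> \<open>Chosen so that the standard Gaussian characteristic function at \<open>R / 2\<close>, and beyond, is at most \<open>\<epsilon> / 4\<close>.\<close>
  define R where "R = sqrt (8 * (\<bar>ln (\<epsilon> / 4)\<bar> + 1))"
  have R: "R > 0" by (simp add: R_def)
  have "R\<^sup>2 / 8 = \<bar>ln (\<epsilon> / 4)\<bar> + 1" by (simp add: R_def)
  then have "- (R\<^sup>2 / 8) \<le> ln (\<epsilon> / 4)" by linarith
  then have "exp (- (R\<^sup>2 / 8)) \<le> exp (ln (\<epsilon> / 4))" by (simp only: exp_le_cancel_iff)
  then have expR: "exp (- (R\<^sup>2 / 8)) \<le> \<epsilon> / 4" using assms by simp
  have "\<forall>\<^sub>F n in sequentially.
      (\<forall>s. \<bar>s\<bar> * sqrt (?B2 n) \<le> R \<longrightarrow> cmod (?D n s) < \<epsilon> / 4) \<and> ?B2 (Suc n) \<le> 4 * ?B2 n"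
    using sum_char_gaussian_uniform_bounded[of "\<epsilon> / 4" R] var_sum_Suc_le assms
    by (intro eventually_conj) auto
  then obtain n0 where n0: "\<And>n s. n0 \<le> n \<Longrightarrow> \<bar>s\<bar> * sqrt (?B2 n) \<le> R \<Longrightarrow> cmod (?D n s) < \<epsilon> / 4"
      "\<And>n. n0 \<le> n \<Longrightarrow> ?B2 (Suc n) \<le> 4 * ?B2 n"
    unfolding eventually_sequentially by blast
  have "\<forall>\<^sub>F s in nhds 0. cmod (?D k s) < \<epsilon>" for k
  proof -
    interpret S: real_distribution "distr M borel (partial_sum X k)" by simp
    have "isCont (\<lambda>s. cmod (?D k s)) 0"
      by (intro continuous_intros S.isCont_char) auto
    then have "((\<lambda>s. cmod (?D k s)) \<longlongrightarrow> cmod (?D k 0)) (nhds 0)"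
      unfolding isCont_def tendsto_at_iff_tendsto_nhds[of "\<lambda>s. cmod (?D k s)" 0] .
    then show ?thesis
      by (rule order_tendstoD) (simp add: S.char_zero assms)
  qed
  then have small: "\<forall>\<^sub>F s in nhds 0. \<forall>k\<in>{..n0}. cmod (?D k s) < \<epsilon>"
    by (intro eventually_ball_finite) auto
  have "((\<lambda>s::real. \<bar>s\<bar> * sqrt (?B2 n0)) \<longlongrightarrow> \<bar>0\<bar> * sqrt (?B2 n0)) (nhds 0)"
    by (intro tendsto_intros) (simp add: filterlim_ident)
  then have "\<forall>\<^sub>F s in nhds 0. \<bar>s\<bar> * sqrt (?B2 n0) < R"
    by (rule order_tendstoD) (simp add: R)
  with small show ?thesis
  proof (eventually_elim, intro allI)
    fix s k
    assume small: "\<forall>k\<in>{..n0}. cmod (?D k s) < \<epsilon>" and s: "\<bar>s\<bar> * sqrt (?B2 n0) < R"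
    consider "k \<le> n0" | "n0 \<le> k" "\<bar>s\<bar> * sqrt (?B2 k) \<le> R" | "n0 \<le> k" "R < \<bar>s\<bar> * sqrt (?B2 k)"
      by linarith
    then show "cmod (?D k s) < \<epsilon>"
    proof cases
      case 1
      then show ?thesis using small by simp
    next
      case 2
      then show ?thesis using n0(1)[of k s] assms by simp
    next
      case 3
      \<comment> \<open>The last index before \<open>\<bar>s\<bar> * B\<^sub>m\<close> first exceeds \<open>R\<close>.\<close>
      have "\<exists>m\<ge>n0. m < k \<and> \<bar>s\<bar> * sqrt (?B2 m) \<le> R \<and> R < \<bar>s\<bar> * sqrt (?B2 (Suc m))"
      proof (rule ccontr)
        assume no: "\<not> ?thesis"
        have "j \<le> k \<longrightarrow> \<bar>s\<bar> * sqrt (?B2 j) \<le> R" if "n0 \<le> j" for j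
          using that
        proof (induction j rule: dec_induct)
          case base
          then show ?case using s by simp
        next
          case (step j)
          then show ?case using no by (metis Suc_le_lessD less_imp_le not_le)
        qed
        then show False using 3 by force
      qed
      then obtain m where m: "n0 \<le> m" "m < k" "\<bar>s\<bar> * sqrt (?B2 m) \<le> R" "R < \<bar>s\<bar> * sqrt (?B2 (Suc m))"
        by blast
      have "R\<^sup>2 \<le> (\<bar>s\<bar> * sqrt (?B2 (Suc m)))\<^sup>2"
        using m(4) R by (intro power_mono) auto
      also have "\<dots> = s\<^sup>2 * ?B2 (Suc m)"
        using var_sum_nonneg[of "Suc m"] by (simp add: power_mult_distrib)
      also have "\<dots> \<le> s\<^sup>2 * (4 * ?B2 m)"
        using n0(2)[OF m(1)] by (intro mult_left_mono) auto
      finally have "R\<^sup>2 / 8 \<le> s\<^sup>2 * ?B2 m / 2" by simp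
      then have gm: "exp (- (s\<^sup>2 * ?B2 m / 2)) \<le> \<epsilon> / 4"
        using expR by (meson dual_order.trans exp_le_cancel_iff le_imp_neg_le)
      have "s\<^sup>2 * ?B2 m \<le> s\<^sup>2 * ?B2 k"
        using var_sum_mono[of m k] m(2) by (intro mult_left_mono) auto
      then have "exp (- (s\<^sup>2 * ?B2 k / 2)) \<le> exp (- (s\<^sup>2 * ?B2 m / 2))" by simp
      with gm have gk: "exp (- (s\<^sup>2 * ?B2 k / 2)) \<le> \<epsilon> / 4" by linarith
      have "cmod (sum_char k s) \<le> cmod (sum_char m s)"
        using m(2) by (intro sum_char_antimono) simp
      also have "\<dots> \<le> cmod (?D m s) + cmod (complex_of_real (exp (- (s\<^sup>2 * ?B2 m / 2))))"
        using norm_triangle_sub[of "sum_char m s" "complex_of_real (exp (- (s\<^sup>2 * ?B2 m / 2)))"] by linarith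
      also have "\<dots> \<le> \<epsilon> / 4 + \<epsilon> / 4"
        using n0(1)[OF m(1,3)] gm by (intro add_mono) auto
      finally have "cmod (sum_char k s) \<le> \<epsilon> / 4 + \<epsilon> / 4" .
      moreover have "cmod (?D k s) \<le> cmod (sum_char k s) + cmod (complex_of_real (exp (- (s\<^sup>2 * ?B2 k / 2))))"
        by (rule norm_triangle_ineq4)
      ultimately show ?thesis using gk assms by (simp only: norm_of_real abs_exp_cancel)
    qed
  qed
qed

end

end

section \<open>Random indices\<close>

lemma sigma_sets_vimage_compose_subset:
  assumes h: "h \<in> measurable K K'" and W: "W \<in> measurable M K"
  shows "sigma_sets (space M) {(\<lambda>\<omega>. h (W \<omega>)) -` A \<inter> space M | A. A \<in> sets K'} \<subseteq>
    sigma_sets (space M) {W -` A \<inter> space M | A. A \<in> sets K}"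
proof (rule sigma_sets_mono', clarify)
  fix A assume "A \<in> sets K'"
  then have "h -` A \<inter> space K \<in> sets K"
    using h by (rule measurable_sets[rotated])
  moreover have "(\<lambda>\<omega>. h (W \<omega>)) -` A \<inter> space M = W -` (h -` A \<inter> space K) \<inter> space M"
    using measurable_space[OF W] by auto
  ultimately show "\<exists>B. (\<lambda>\<omega>. h (W \<omega>)) -` A \<inter> space M = W -` B \<inter> space M \<and> B \<in> sets K"
    by blast
qed

lemma (in prob_space) independent_rvs_indep_var_compose:
  assumes UV: "independent_rvs M S U T V"
    and f: "f \<in> measurable S R" and g: "g \<in> measurable T R'"
  shows "indep_var R (\<lambda>\<omega>. f (U \<omega>)) R' (\<lambda>\<omega>. g (V \<omega>))"
proof -
  have U: "U \<in> measurable M S" and V: "V \<in> measurable M T"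
    using UV by (auto simp: independent_rvs_def)
  have "indep_set (sigma_sets (space M) {U -` A \<inter> space M | A. A \<in> sets S})
      (sigma_sets (space M) {V -` A \<inter> space M | A. A \<in> sets T})"
    using UV by (simp add: independent_rvs_def)
  then have "indep_set (sigma_sets (space M) {(\<lambda>\<omega>. f (U \<omega>)) -` A \<inter> space M | A. A \<in> sets R})
      (sigma_sets (space M) {(\<lambda>\<omega>. g (V \<omega>)) -` A \<inter> space M | A. A \<in> sets R'})"
    unfolding indep_set_def
    by (rule indep_sets_mono_sets)
       (use sigma_sets_vimage_compose_subset[OF f U] sigma_sets_vimage_compose_subset[OF g V]
         in \<open>simp split: bool.split\<close>)
  then show ?thesis
    unfolding indep_var_eq using measurable_compose[OF U f] measurable_compose[OF V g] by simp
qed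

text \<open>
  Fubini for an independent random index, where the integer-valued index and the family it selects
  from take values in different types. The events \<open>N = k\<close> are split off one at a time by
  independence; dominated convergence adds them up.
\<close>

lemma (in prob_space) expectation_random_index:
  fixes h :: "nat \<Rightarrow> 'b \<Rightarrow> complex"
  assumes NV: "independent_rvs M (count_space UNIV) N T V"
    and h [measurable]: "\<And>k. h k \<in> borel_measurable T"
    and bound: "\<And>k v. cmod (h k v) \<le> 1"
  shows "expectation (\<lambda>\<omega>. h (N \<omega>) (V \<omega>)) = expectation (\<lambda>\<omega>. LINT \<omega>'|M. h (N \<omega>) (V \<omega>'))"
proof -
  have N [measurable]: "N \<in> measurable M (count_space UNIV)" and V [measurable]: "V \<in> measurable M T"
    using NV by (auto simp: independent_rvs_def)
  let ?g = "\<lambda>k. LINT \<omega>'|M. h k (V \<omega>')"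
  let ?i = "\<lambda>k \<omega>. indicator {k} (N \<omega>) :: complex"
  have int_h: "integrable M (\<lambda>\<omega>. h k (V \<omega>))" for k
    by (rule integrable_const_bound[of _ 1]) (auto simp: bound)
  have int_i: "integrable M (?i k)" for k
    by (rule integrable_const_bound[of _ 1]) (auto simp: indicator_def)
  have ind: "indep_var borel (?i k) borel (\<lambda>\<omega>. h k (V \<omega>))" for k
    by (rule independent_rvs_indep_var_compose[OF NV, where f = "indicator {k}"]) auto
  have g1: "cmod (?g k) \<le> 1" for k
    by (rule order_trans[OF integral_norm_bound], rule integral_le_const)
       (auto simp: bound int_h)
  have truncated: "expectation (\<lambda>\<omega>. \<Sum>k<n. ?i k \<omega> * h k (V \<omega>)) = expectation (\<lambda>\<omega>. \<Sum>k<n. ?i k \<omega> * ?g k)" for n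
  proof -
    have "expectation (\<lambda>\<omega>. \<Sum>k<n. ?i k \<omega> * h k (V \<omega>)) = (\<Sum>k<n. expectation (\<lambda>\<omega>. ?i k \<omega> * h k (V \<omega>)))"
      by (intro Bochner_Integration.integral_sum indep_var_integrable[OF ind int_i int_h])
    also have "\<dots> = (\<Sum>k<n. expectation (\<lambda>\<omega>. ?i k \<omega> * ?g k))"
      using indep_var_lebesgue_integral[OF ind int_i int_h] by simp
    also have "\<dots> = expectation (\<lambda>\<omega>. \<Sum>k<n. ?i k \<omega> * ?g k)"
      by (intro Bochner_Integration.integral_sum[symmetric] integrable_mult_left int_i)
    finally show ?thesis .
  qed
  have select: "(\<Sum>k<n. ?i k \<omega> * c k) = (if N \<omega> < n then c (N \<omega>) else 0)" for c n \<omega>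
    by (simp add: indicator_def if_distrib[of "\<lambda>x. x * _"] cong: if_cong)
  have lim: "(\<lambda>n. expectation (\<lambda>\<omega>. \<Sum>k<n. ?i k \<omega> * c k \<omega>)) \<longlonglongrightarrow> expectation (\<lambda>\<omega>. c (N \<omega>) \<omega>)"
    if [measurable]: "\<And>k. c k \<in> borel_measurable M" and c: "\<And>k \<omega>. cmod (c k \<omega>) \<le> 1" for c
  proof (rule integral_dominated_convergence[where w = "\<lambda>_. 1"])
    show "AE \<omega> in M. (\<lambda>n. \<Sum>k<n. ?i k \<omega> * c k \<omega>) \<longlonglongrightarrow> c (N \<omega>) \<omega>"
    proof (rule AE_I2, rule tendsto_eventually)
      fix \<omega>
      show "\<forall>\<^sub>F n in sequentially. (\<Sum>k<n. ?i k \<omega> * c k \<omega>) = c (N \<omega>) \<omega>"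
        using eventually_gt_at_top[of "N \<omega>"] by eventually_elim (simp add: select)
    qed
  qed (auto simp: select c)
  show ?thesis
    using lim[of "\<lambda>k \<omega>. h k (V \<omega>)"] lim[of "\<lambda>k \<omega>. ?g k"] bound g1
    unfolding truncated by (auto intro: LIMSEQ_unique)
qed

section \<open>Continuity theorem for Laplace transforms\<close>

text \<open>
  The Laplace transform at \<open>j\<close> is the \<open>j\<close>-th moment of \<open>exp (- x)\<close>, which lies in the unit
  interval. Convergence of all moments gives convergence of the integrals of polynomials, and by
  Weierstrass approximation of all continuous functions on the unit interval.
\<close>

lemma integral_continuous_exp_minus_tendsto:
  fixes \<mu> :: "nat \<Rightarrow> real measure"
  assumes \<mu>: "\<And>n. real_distribution (\<mu> n)" "\<And>n. AE x in \<mu> n. 0 \<le> x"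
    and \<nu>: "real_distribution \<nu>" "AE x in \<nu>. 0 \<le> x"
    and lim: "\<And>j::nat. (\<lambda>n. LINT x|\<mu> n. exp (- (real j * x))) \<longlonglongrightarrow> (LINT x|\<nu>. exp (- (real j * x)))"
    and f: "continuous_on UNIV f"
  shows "(\<lambda>n. LINT x|\<mu> n. f (exp (- x))) \<longlonglongrightarrow> (LINT x|\<nu>. f (exp (- x)) :: real)"
proof (rule LIMSEQ_I)
  fix \<epsilon> :: real assume "0 < \<epsilon>"
  have "\<exists>g. real_polynomial_function g \<and> (\<forall>x\<in>{0..1}. \<bar>f x - g x\<bar> < \<epsilon> / 4)"
    using \<open>0 < \<epsilon>\<close> continuous_on_subset[OF f, of "{0..1}"]
    by (metis Stone_Weierstrass_real_polynomial_function compact_Icc divide_pos_pos subset_UNIV zero_less_numeral)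
  then obtain a and m :: nat where approx: "\<And>y. y \<in> {0..1} \<Longrightarrow> \<bar>f y - (\<Sum>i\<le>m. a i * y ^ i)\<bar> < \<epsilon> / 4"
    unfolding real_polynomial_function_iff_sum by blast
  let ?p = "\<lambda>x. \<Sum>i\<le>m. a i * exp (- (real i * x))"
  have p_eq: "(\<Sum>i\<le>m. a i * exp (- x) ^ i) = ?p x" for x
    by (simp add: exp_of_nat_mult[symmetric])
  have f_meas [measurable]: "f \<in> borel_measurable borel"
    using f by (rule borel_measurable_continuous_onI)
  obtain C where C: "\<And>y. y \<in> {0..1} \<Longrightarrow> \<bar>f y\<bar> \<le> C"
    using compact_imp_bounded[OF compact_continuous_image[OF continuous_on_subset[OF f] compact_Icc]]
    unfolding bounded_iff by (metis imageI real_norm_def subset_UNIV)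
  have int_exp: "integrable \<rho> (\<lambda>x. exp (- (real i * x)))"
    and close: "\<bar>(LINT x|\<rho>. f (exp (- x))) - (\<Sum>i\<le>m. a i * (LINT x|\<rho>. exp (- (real i * x))))\<bar> \<le> \<epsilon> / 4"
    if \<rho>: "real_distribution \<rho>" "AE x in \<rho>. 0 \<le> x" for \<rho> i
  proof -
    interpret \<rho>: real_distribution \<rho> by fact
    show int_exp: "integrable \<rho> (\<lambda>x. exp (- (real i * x)))" for i
      by (rule \<rho>.integrable_const_bound[of _ 1]) (use \<rho>(2) in auto)
    have int_f: "integrable \<rho> (\<lambda>x. f (exp (- x)))"
      by (rule \<rho>.integrable_const_bound[of _ C]) (use \<rho>(2) C in auto)
    have int_p: "integrable \<rho> ?p"
      using int_exp by auto
    have "(LINT x|\<rho>. ?p x) = (\<Sum>i\<le>m. a i * (LINT x|\<rho>. exp (- (real i * x))))"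
      using int_exp by (subst Bochner_Integration.integral_sum) auto
    then have "\<bar>(LINT x|\<rho>. f (exp (- x))) - (\<Sum>i\<le>m. a i * (LINT x|\<rho>. exp (- (real i * x))))\<bar> =
        \<bar>LINT x|\<rho>. f (exp (- x)) - ?p x\<bar>"
      using int_f int_p by simp
    also have "\<dots> \<le> (LINT x|\<rho>. \<bar>f (exp (- x)) - ?p x\<bar>)"
      by (rule integral_abs_bound)
    also have "\<dots> \<le> \<epsilon> / 4"
    proof (rule \<rho>.integral_le_const)
      show "AE x in \<rho>. \<bar>f (exp (- x)) - ?p x\<bar> \<le> \<epsilon> / 4"
        using \<rho>(2)
      proof eventually_elim
        case (elim x)
        then show ?case using approx[of "exp (- x)"] unfolding p_eq by auto
      qed
    qed (use int_f int_p in auto)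
    finally show "\<bar>(LINT x|\<rho>. f (exp (- x))) - (\<Sum>i\<le>m. a i * (LINT x|\<rho>. exp (- (real i * x))))\<bar> \<le> \<epsilon> / 4" .
  qed
  let ?P = "\<lambda>\<rho>. \<Sum>i\<le>m. a i * (LINT x|\<rho>. exp (- (real i * x)))"
  have "(\<lambda>n. ?P (\<mu> n)) \<longlonglongrightarrow> ?P \<nu>"
    by (intro tendsto_intros lim)
  from LIMSEQ_D[OF this, of "\<epsilon> / 4"] \<open>0 < \<epsilon>\<close>
  obtain n0 where n0: "\<And>n. n \<ge> n0 \<Longrightarrow> norm (?P (\<mu> n) - ?P \<nu>) < \<epsilon> / 4"
    by auto
  show "\<exists>n0. \<forall>n\<ge>n0. norm ((LINT x|\<mu> n. f (exp (- x))) - (LINT x|\<nu>. f (exp (- x)))) < \<epsilon>"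
  proof (intro exI[of _ n0] allI impI)
    fix n assume "n0 \<le> n"
    then show "norm ((LINT x|\<mu> n. f (exp (- x))) - (LINT x|\<nu>. f (exp (- x)))) < \<epsilon>"
      using n0[of n] close[OF \<mu>, of n] close[OF \<nu>] \<open>0 < \<epsilon>\<close> unfolding real_norm_def by linarith
  qed
qed

text \<open>
  Continuity theorem for Laplace transforms at integer arguments. Continuous functions of
  \<open>exp (- x)\<close> include the continuous approximations \<open>cts_step a b\<close> of the indicators of
  half-lines, because these vanish near infinity; convergence of their integrals is weak convergence.
\<close>

theorem laplace_continuity:
  fixes \<mu> :: "nat \<Rightarrow> real measure"
  assumes \<mu>: "\<And>n. real_distribution (\<mu> n)" "\<And>n. AE x in \<mu> n. 0 \<le> x"
    and \<nu>: "real_distribution \<nu>" "AE x in \<nu>. 0 \<le> x"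
    and lim: "\<And>j::nat. (\<lambda>n. LINT x|\<mu> n. exp (- (real j * x))) \<longlonglongrightarrow> (LINT x|\<nu>. exp (- (real j * x)))"
  shows "weak_conv_m \<mu> \<nu>"
proof (rule integral_cts_step_conv_imp_weak_conv[OF \<mu>(1) \<nu>(1)])
  fix a b :: real assume "a < b"
  \<comment> \<open>The maximum keeps the logarithm away from 0; it alters the argument of the step only beyond \<open>b\<close>, where the step is 0 anyway.\<close>
  let ?f = "\<lambda>y. cts_step a b (- ln (max y (exp (- b))))"
  have "continuous_on UNIV (cts_step a b)"
    using cts_step_uniformly_continuous[OF \<open>a < b\<close>] by (rule uniformly_continuous_imp_continuous)
  moreover have "continuous_on UNIV (\<lambda>y::real. - ln (max y (exp (- b))))"
    by (intro continuous_intros) (auto simp: max_def not_le[symmetric])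
  ultimately have "continuous_on UNIV ?f"
    by (rule continuous_on_compose2) auto
  from integral_continuous_exp_minus_tendsto[OF \<mu> \<nu> lim this]
  have "(\<lambda>n. LINT x|\<mu> n. ?f (exp (- x))) \<longlonglongrightarrow> (LINT x|\<nu>. ?f (exp (- x)))" .
  moreover have "?f (exp (- x)) = cts_step a b x" for x
    using \<open>a < b\<close> by (auto simp: max_def cts_step_def)
  ultimately show "(\<lambda>n. integral\<^sup>L (\<mu> n) (cts_step a b)) \<longlonglongrightarrow> integral\<^sup>L \<nu> (cts_step a b)"
    by simp
qed

section \<open>Random sums and random variances\<close>

lemma weak_conv_m_Suc_iff: "weak_conv_m (\<lambda>n. \<mu> (Suc n)) \<nu> \<longleftrightarrow> weak_conv_m \<mu> \<nu>"
  unfolding weak_conv_m_def weak_conv_def by (simp add: filterlim_sequentially_Suc[where f = "\<lambda>n. cdf (\<mu> n) _"])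

text \<open>
  The first conclusion is the measurability that makes the law of a random sum meaningful.
\<close>

lemma (in centered_summands) char_random_sum:
  assumes indep_N: "independent_rvs M (count_space UNIV) N
      (Pi\<^sub>M {1..} (\<lambda>_. borel)) (\<lambda>\<omega>. \<lambda>i\<in>{1..}. X i \<omega>)"
  shows "(\<lambda>\<omega>. partial_sum X (N \<omega>) \<omega>) \<in> borel_measurable M"
    and "char (distr M borel (\<lambda>\<omega>. partial_sum X (N \<omega>) \<omega> / c)) t = expectation (\<lambda>\<omega>. sum_char (N \<omega>) (t / c))"
proof -
  have N [measurable]: "N \<in> measurable M (count_space UNIV)"
    using indep_N by (simp add: independent_rvs_def)
  show meas [measurable]: "(\<lambda>\<omega>. partial_sum X (N \<omega>) \<omega>) \<in> borel_measurable M"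
    by (rule measurable_compose_countable) auto
  let ?V = "\<lambda>\<omega>. \<lambda>i\<in>{1..}. X i \<omega>"
  let ?h = "\<lambda>k (v :: nat \<Rightarrow> real). iexp (t / c * (\<Sum>i=1..k. v i))"
  have "(\<lambda>v :: nat \<Rightarrow> real. \<Sum>i=1..k. v i) \<in> borel_measurable (Pi\<^sub>M {1..} (\<lambda>_. borel))" for k
    by (intro borel_measurable_sum measurable_component_singleton) auto
  then have h: "?h k \<in> borel_measurable (Pi\<^sub>M {1..} (\<lambda>_. borel))" for k
    by measurable
  have V: "(\<Sum>i=1..k. ?V \<omega> i) = partial_sum X k \<omega>" for k \<omega>
    by (simp add: partial_sum_def)
  have "char (distr M borel (\<lambda>\<omega>. partial_sum X (N \<omega>) \<omega> / c)) t = expectation (\<lambda>\<omega>. ?h (N \<omega>) (?V \<omega>))"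
    unfolding char_def V by (subst integral_distr) auto
  also have "\<dots> = expectation (\<lambda>\<omega>. LINT \<omega>'|M. ?h (N \<omega>) (?V \<omega>'))"
    by (rule expectation_random_index[OF indep_N h]) simp
  also have "\<dots> = expectation (\<lambda>\<omega>. sum_char (N \<omega>) (t / c))"
    unfolding char_def V by (subst integral_distr) auto
  finally show "char (distr M borel (\<lambda>\<omega>. partial_sum X (N \<omega>) \<omega> / c)) t = expectation (\<lambda>\<omega>. sum_char (N \<omega>) (t / c))" .
qed

text \<open>
  Conditionally on the index, the normalised sum has characteristic function \<open>sum_char k (t / d n)\<close>,
  which is uniformly close in \<open>k\<close> to \<open>exp (- (t / d n)\<^sup>2 * B\<^sub>k\<^sup>2 / 2)\<close> as \<open>t / d n\<close> tends to 0.
  Averaging over the index turns the latter into the Laplace transform of the normalised random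
  variance at \<open>t\<^sup>2 / 2\<close>.
\<close>

lemma (in centered_summands) char_random_sum_minus_laplace_tendsto_0:
  assumes lindeberg: "lindeberg_condition M X"
    and indep_N: "\<And>n. independent_rvs M (count_space UNIV) (N n)
      (Pi\<^sub>M {1..} (\<lambda>_. borel)) (\<lambda>\<omega>. \<lambda>i\<in>{1..}. X i \<omega>)"
    and d: "filterlim d at_top sequentially"
  shows "(\<lambda>n. char (distr M borel (\<lambda>\<omega>. partial_sum X (N n \<omega>) \<omega> / d n)) t -
    complex_of_real (LINT x|distr M borel (\<lambda>\<omega>. var_sum M X (N n \<omega>) / (d n)\<^sup>2). exp (- (t\<^sup>2 / 2 * x)))) \<longlonglongrightarrow> 0"
proof (rule LIMSEQ_I)
  fix \<epsilon> :: real assume "0 < \<epsilon>"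
  have N [measurable]: "N n \<in> measurable M (count_space UNIV)" for n
    using indep_N by (simp add: independent_rvs_def)
  let ?G = "\<lambda>n \<omega>. exp (- ((t / d n)\<^sup>2 * var_sum M X (N n \<omega>) / 2))"
  have "(\<lambda>n. t / d n) \<longlonglongrightarrow> 0"
    using d by (intro tendsto_divide_0[OF tendsto_const] filterlim_at_top_imp_at_infinity)
  moreover have "\<forall>\<^sub>F s in nhds 0. \<forall>k. cmod (sum_char k s - exp (- (s\<^sup>2 * var_sum M X k / 2))) < \<epsilon> / 2"
    using \<open>0 < \<epsilon>\<close> by (intro sum_char_gaussian_uniform lindeberg) simp
  ultimately have "\<forall>\<^sub>F n in sequentially. \<forall>k.
      cmod (sum_char k (t / d n) - exp (- ((t / d n)\<^sup>2 * var_sum M X k / 2))) < \<epsilon> / 2"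
    by (rule eventually_compose_filterlim[rotated])
  then obtain n0 where n0: "\<And>n k. n0 \<le> n \<Longrightarrow>
      cmod (sum_char k (t / d n) - exp (- ((t / d n)\<^sup>2 * var_sum M X k / 2))) < \<epsilon> / 2"
    unfolding eventually_sequentially by blast
  have "norm (char (distr M borel (\<lambda>\<omega>. partial_sum X (N n \<omega>) \<omega> / d n)) t -
    complex_of_real (LINT x|distr M borel (\<lambda>\<omega>. var_sum M X (N n \<omega>) / (d n)\<^sup>2). exp (- (t\<^sup>2 / 2 * x))) - 0) < \<epsilon>"
    if "n0 \<le> n" for n
  proof -
    have "cmod (sum_char k s) \<le> 1" for k s
      by (rule real_distribution.cmod_char_le_1) simp
    then have int_char: "integrable M (\<lambda>\<omega>. sum_char (N n \<omega>) (t / d n))"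
      by (intro integrable_const_bound[of _ 1]) auto
    have int_G: "integrable M (?G n)"
      by (intro integrable_const_bound[of _ 1]) (auto simp: var_sum_nonneg)
    have "complex_of_real (LINT x|distr M borel (\<lambda>\<omega>. var_sum M X (N n \<omega>) / (d n)\<^sup>2). exp (- (t\<^sup>2 / 2 * x))) =
        expectation (\<lambda>\<omega>. complex_of_real (?G n \<omega>))"
      by (subst integral_distr) (auto simp: power_divide mult_ac)
    then have "norm (char (distr M borel (\<lambda>\<omega>. partial_sum X (N n \<omega>) \<omega> / d n)) t -
        complex_of_real (LINT x|distr M borel (\<lambda>\<omega>. var_sum M X (N n \<omega>) / (d n)\<^sup>2). exp (- (t\<^sup>2 / 2 * x))) - 0) =
        norm (expectation (\<lambda>\<omega>. sum_char (N n \<omega>) (t / d n) - complex_of_real (?G n \<omega>)))"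
      using int_char int_G by (simp add: char_random_sum(2)[OF indep_N])
    also have "\<dots> \<le> expectation (\<lambda>\<omega>. norm (sum_char (N n \<omega>) (t / d n) - complex_of_real (?G n \<omega>)))"
      by (rule integral_norm_bound)
    also have "\<dots> \<le> \<epsilon> / 2"
      using int_char int_G n0[OF that] by (intro integral_le_const AE_I2) (auto intro: less_imp_le)
    finally show ?thesis using \<open>0 < \<epsilon>\<close> by linarith
  qed
  then show "\<exists>n0. \<forall>n\<ge>n0. norm (char (distr M borel (\<lambda>\<omega>. partial_sum X (N n \<omega>) \<omega> / d n)) t -
    complex_of_real (LINT x|distr M borel (\<lambda>\<omega>. var_sum M X (N n \<omega>) / (d n)\<^sup>2). exp (- (t\<^sup>2 / 2 * x))) - 0) < \<epsilon>"
    by blast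
qed

text \<open>
  The Linnik law is a variance mixture of centred normal laws: at \<open>t\<^sup>2 / 2\<close> the Laplace transform of
  the doubled Mittag-Leffler law is the Linnik characteristic function at \<open>t\<close>.
\<close>

lemma mittag_leffler_double_transform:
  assumes "mittag_leffler_distribution (\<alpha> / 2) Q"
  shows "(LINT x|distr Q borel (\<lambda>x. 2 * x). exp (- (t\<^sup>2 / 2 * x))) = 1 / (1 + \<bar>t\<bar> powr \<alpha>)"
proof -
  have "sets Q = sets borel" and laplace: "\<And>s. 0 \<le> s \<Longrightarrow> (LINT x|Q. exp (- s * x)) = 1 / (1 + s powr (\<alpha> / 2))"
    using assms by (auto simp: mittag_leffler_distribution_def real_distribution_def real_distribution_axioms_def)
  then have "(LINT x|distr Q borel (\<lambda>x. 2 * x). exp (- (t\<^sup>2 / 2 * x))) = (LINT x|Q. exp (- (t\<^sup>2) * x))"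
    by (subst integral_distr) (auto cong: measurable_cong_sets)
  also have "\<dots> = 1 / (1 + (\<bar>t\<bar>\<^sup>2) powr (\<alpha> / 2))"
    using laplace[of "t\<^sup>2"] by simp
  also have "(\<bar>t\<bar>\<^sup>2) powr (\<alpha> / 2) = \<bar>t\<bar> powr \<alpha>"
  proof (cases "t = 0")
    case False
    then have "\<bar>t\<bar>\<^sup>2 = \<bar>t\<bar> powr 2" by simp
    then have "(\<bar>t\<bar>\<^sup>2) powr (\<alpha> / 2) = \<bar>t\<bar> powr (2 * (\<alpha> / 2))" by (simp only: powr_powr)
    then show ?thesis by simp
  qed simp
  finally show ?thesis .
qed

theorem theorem4:
  fixes M :: "'a measure"
    and X :: "nat \<Rightarrow> 'a \<Rightarrow> real"
    and N :: "nat \<Rightarrow> 'a \<Rightarrow> nat"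
    and d :: "nat \<Rightarrow> real"
    and \<alpha> :: real
    and L Q :: "real measure"
  assumes "prob_space M"
    and "0 < \<alpha>" "\<alpha> \<le> 2"
    and "prob_space.indep_vars M (\<lambda>_. borel) X {1..}"
    and "\<And>i. i \<ge> 1 \<Longrightarrow> integrable M (X i)"
    and "\<And>i. i \<ge> 1 \<Longrightarrow> integrable M (\<lambda>\<omega>. (X i \<omega>)\<^sup>2)"
    and "\<And>i. i \<ge> 1 \<Longrightarrow> prob_space.expectation M (X i) = 0"
    and "\<And>i. i \<ge> 1 \<Longrightarrow> 0 < prob_space.variance M (X i)"
    and "lindeberg_condition M X"
    and "\<And>n. n \<ge> 1 \<Longrightarrow>
           independent_rvs M (count_space UNIV) (N n)
             (Pi\<^sub>M {1..} (\<lambda>_. borel)) (\<lambda>\<omega>. \<lambda>i\<in>{1..}. X i \<omega>)"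
    and "\<And>m::real. m > 0 \<Longrightarrow>
           (\<lambda>n. measure M {\<omega> \<in> space M. real (N n \<omega>) \<le> m}) \<longlonglongrightarrow> 0"
    and "\<And>n. n \<ge> 1 \<Longrightarrow> 0 < d n"
    and "filterlim d at_top sequentially"
    and "linnik_distribution \<alpha> L"
    and "mittag_leffler_distribution (\<alpha> / 2) Q"
  shows "weak_conv_m (\<lambda>n. distr M borel (\<lambda>\<omega>. partial_sum X (N n \<omega>) \<omega> / d n)) L \<longleftrightarrow>
         weak_conv_m (\<lambda>n. distr M borel (\<lambda>\<omega>. var_sum M X (N n \<omega>) / (d n)\<^sup>2))
           (distr Q borel (\<lambda>x. 2 * x))"
proof -
  interpret centered_summands M X
    using assms(1,4-8) by (simp add: centered_summands_def centered_summands_axioms_def)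
  \<comment> \<open>Indices start at 1: nothing is known about \<open>N 0\<close>, not even measurability.\<close>
  let ?S = "\<lambda>n. distr M borel (\<lambda>\<omega>. partial_sum X (N (Suc n) \<omega>) \<omega> / d (Suc n))"
  let ?U = "\<lambda>n. distr M borel (\<lambda>\<omega>. var_sum M X (N (Suc n) \<omega>) / (d (Suc n))\<^sup>2)"
  let ?Q = "distr Q borel (\<lambda>x. 2 * x)"
  have indep_N: "\<And>n. independent_rvs M (count_space UNIV) (N (Suc n))
      (Pi\<^sub>M {1..} (\<lambda>_. borel)) (\<lambda>\<omega>. \<lambda>i\<in>{1..}. X i \<omega>)"
    using assms(10) by simp
  have N [measurable]: "N (Suc n) \<in> measurable M (count_space UNIV)" for n
    using indep_N by (simp add: independent_rvs_def)
  have [measurable]: "(\<lambda>\<omega>. partial_sum X (N (Suc n) \<omega>) \<omega>) \<in> borel_measurable M" for n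
    by (rule char_random_sum(1)[OF indep_N])
  have S: "real_distribution (?S n)" and U: "real_distribution (?U n)" for n
    by (auto intro!: real_distribution_distr)
  have U_nonneg: "AE x in ?U n. 0 \<le> x" for n
    by (subst AE_distr_iff) (auto simp: var_sum_nonneg)
  have L: "real_distribution L" and char_L: "\<And>t. char L t = complex_of_real (1 / (1 + \<bar>t\<bar> powr \<alpha>))"
    using assms(14) by (auto simp: linnik_distribution_def)
  interpret Q: real_distribution Q
    using assms(15) by (simp add: mittag_leffler_distribution_def)
  have Q: "real_distribution ?Q"
    by (intro Q.real_distribution_distr) auto
  have Q_nonneg: "AE x in ?Q. 0 \<le> x"
    using assms(15) by (subst AE_distr_iff) (auto simp: mittag_leffler_distribution_def)
  note laplace_Q = mittag_leffler_double_transform[OF assms(15)]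
  let ?A = "\<lambda>n t. char (?S n) t"
  let ?C = "\<lambda>n t. LINT x|?U n. exp (- (t\<^sup>2 / 2 * x))"
  have diff: "(\<lambda>n. ?A n t - complex_of_real (?C n t)) \<longlonglongrightarrow> 0" for t
    using assms(13) by (intro char_random_sum_minus_laplace_tendsto_0 assms(9) indep_N)
      (simp add: filterlim_sequentially_Suc)
  have transforms: "(\<lambda>n. ?A n t) \<longlonglongrightarrow> char L t \<longleftrightarrow> (\<lambda>n. ?C n t) \<longlonglongrightarrow> (LINT x|?Q. exp (- (t\<^sup>2 / 2 * x)))" for t
  proof -
    have "(\<lambda>n. ?A n t) \<longlonglongrightarrow> char L t \<longleftrightarrow> (\<lambda>n. complex_of_real (?C n t)) \<longlonglongrightarrow> char L t"
      using Lim_transform[OF _ diff[of t]] Lim_transform2[OF _ diff[of t]] by (rule iffI[rotated])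
    then show ?thesis
      unfolding char_L laplace_Q by (simp only: tendsto_of_real_iff)
  qed
  have "weak_conv_m ?S L \<longleftrightarrow> weak_conv_m ?U ?Q"
  proof
    assume "weak_conv_m ?S L"
    then have "(\<lambda>n. ?A n t) \<longlonglongrightarrow> char L t" for t
      by (rule levy_continuity1[OF S L])
    then have laplace_lim: "(\<lambda>n. ?C n t) \<longlonglongrightarrow> (LINT x|?Q. exp (- (t\<^sup>2 / 2 * x)))" for t
      by (simp only: transforms)
    show "weak_conv_m ?U ?Q"
    proof (intro laplace_continuity U U_nonneg Q Q_nonneg)
      fix j :: nat
      have "(sqrt (2 * real j))\<^sup>2 / 2 = real j" by simp
      then show "(\<lambda>n. LINT x|?U n. exp (- (real j * x))) \<longlonglongrightarrow> (LINT x|?Q. exp (- (real j * x)))"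
        using laplace_lim[of "sqrt (2 * real j)"] by (simp only:)
    qed
  next
    assume conv: "weak_conv_m ?U ?Q"
    have "(\<lambda>n. ?C n t) \<longlonglongrightarrow> (LINT x|?Q. exp (- (t\<^sup>2 / 2 * x)))" for t
    proof -
      \<comment> \<open>The exponential is bounded only on the half-line that carries the laws.\<close>
      have "(\<lambda>n. LINT x|?U n. exp (- (t\<^sup>2 / 2 * max 0 x))) \<longlonglongrightarrow> (LINT x|?Q. exp (- (t\<^sup>2 / 2 * max 0 x)))"
        by (rule weak_conv_imp_integral_bdd_continuous_conv[OF U Q conv, where B = 1])
           (simp_all add: continuous_intros)
      moreover have "(LINT x|\<mu>. exp (- (t\<^sup>2 / 2 * max 0 x))) = (LINT x|\<mu>. exp (- (t\<^sup>2 / 2 * x)))"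
        if "sets \<mu> = sets borel" "AE x in \<mu>. 0 \<le> x" for \<mu> :: "real measure"
      proof (rule integral_cong_AE)
        show "AE x in \<mu>. exp (- (t\<^sup>2 / 2 * max 0 x)) = exp (- (t\<^sup>2 / 2 * x))"
          using that(2) by eventually_elim simp
      qed (simp_all add: measurable_cong_sets[OF that(1) refl])
      ultimately show ?thesis
        using U_nonneg Q_nonneg by simp
    qed
    then have "(\<lambda>n. ?A n t) \<longlonglongrightarrow> char L t" for t
      by (simp only: transforms)
    then show "weak_conv_m ?S L"
      by (rule levy_continuity[OF S L])
  qed
  then show ?thesis
    by (simp add: weak_conv_m_Suc_iff[where \<mu> = "\<lambda>n. distr M borel (\<lambda>\<omega>. partial_sum X (N n \<omega>) \<omega> / d n)"]
      weak_conv_m_Suc_iff[where \<mu> = "\<lambda>n. distr M borel (\<lambda>\<omega>. var_sum M X (N n \<omega>) / (d n)\<^sup>2)"])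
qed

end
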